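(* Let $(s_n(x))_{n\ge 0}$ be the Sheffer sequence for the pair $(g(t),k(t))$ of power series, where $O(g(t))=0$ and $O(k(t))=1$, and let $k^{-1}(t)$ be the compositional inverse of $k(t)$. Let $v(t)=\sum_{i\ge 0}A_i t^i$ be a power series, let $v(\partial_x)=\sum_{i\ge 0}A_i(\partial_x)^i$ be the corresponding linear operator, and let $j(x)$ be an arbitrary function on which $v(\partial_x)$ is well defined (in the sense that the operators occurring below are defined on the functions to which they are applied). Then for every positive integer $n$, \[ v(\partial_x)\,[s_n(x)\,j(x)] = \sum_{m=0}^{n}\binom{n}{m}\, s_{n-m}(x)\,\Big[(\partial_r)^{m}\,v\big(\partial_x+k^{-1}(r)\big)\Big]_{r=0}\, j(x), \] where $\partial_x$ is treated as a constant when $\partial_r$ is applied.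
   Context: For a nonzero power series $h(t)$, $O(h(t))$ is the smallest integer $i$ such that the coefficient of $t^i$ in $h$ is nonzero. With $O(g)=0$ and $O(k)=1$, the Sheffer sequence for $(g(t),k(t))$ is the polynomial sequence $s_n(x)$ determined by \[ \frac{1}{g(k^{-1}(t))}\,e^{x k^{-1}(t)}=\sum_{n=0}^{\infty}\frac{s_n(x)\,t^n}{n!}, \] where $k^{-1}$ satisfies $k(k^{-1}(t))=k^{-1}(k(t))=t$. $\partial_x$ and $\partial_r$ denote differentiation with respect to $x$ and $r$. The operator $\big[(\partial_r)^m v(\partial_x+k^{-1}(r))\big]_{r=0}$ is the one obtained by forming the power series in $t$ given by $\frac{\partial^m}{\partial r^m} v(t+k^{-1}(r))\big|_{r=0}$ and then substituting $t=\partial_x$. *)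

theory Defs
  imports
    "HOL-Analysis.Derivative"
    "HOL-Computational_Algebra.Formal_Power_Series"
    "HOL-Computational_Algebra.Polynomial"
begin

unbundle no vec_syntax
unbundle fps_syntax

(* fps_exp x is the series e^(x t), so fps_exp x oo fps_inv k is e^(x k^-1(t)).  The identity is
   required at every point x of an infinite field, which determines the polynomials s n. *)
definition is_sheffer_seq ::
    "'a::field_char_0 fps \<Rightarrow> 'a fps \<Rightarrow> (nat \<Rightarrow> 'a poly) \<Rightarrow> bool" where
  "is_sheffer_seq g k s \<longleftrightarrow>
     (\<forall>x. inverse (g oo fps_inv k) * (fps_exp x oo fps_inv k) =
          Abs_fps (\<lambda>n. poly (s n) x / fact n))"

(* Double series in t and r have type 'a fps fps: the outer variable is r and the inner one is t,
   so fps_nth (fps_nth F b) a is the coefficient of t^a r^b in F.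
   lift_r y is y(r), constant in t, whereas fps_const y is y(t), constant in r. *)
definition lift_r :: "'a::zero fps \<Rightarrow> 'a fps fps" where
  "lift_r y = Abs_fps (\<lambda>b. fps_const (y $ b))"

(* v(t + y(r)) = sum over i of v_i (t + y(r))^i for y with zero constant term.  The coefficient
   of t^a r^b is a finite sum, since (t + y(r))^i has no term of total degree below i; see
   shift_power_nth_eq_0. *)
definition fps_shift_arg :: "'a::comm_ring_1 fps \<Rightarrow> 'a fps \<Rightarrow> 'a fps fps" where
  "fps_shift_arg v y =
     Abs_fps (\<lambda>b. Abs_fps (\<lambda>a. \<Sum>i\<le>a + b. v $ i * ((fps_const fps_X + lift_r y) ^ i) $ b $ a))"

lemma shift_power_nth_eq_0:
  fixes y :: "'a::comm_ring_1 fps"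
  assumes y0: "y $ 0 = 0" and "a + b < i"
  shows "((fps_const fps_X + lift_r y) ^ i) $ b $ a = 0"
  using assms(2)
proof (induction i arbitrary: a b)
  case 0
  then show ?case by simp
next
  case (Suc i)
  define P where "P = (fps_const fps_X + lift_r y) ^ i"
  have "((fps_const fps_X + lift_r y) ^ Suc i) $ b $ a =
        (fps_X * P $ b) $ a + (\<Sum>c=0..b. y $ c * P $ (b - c) $ a)"
  proof -
    have "(lift_r y * P) $ b $ a = (\<Sum>c=0..b. y $ c * P $ (b - c) $ a)"
      unfolding fps_mult_nth by (simp add: lift_r_def fps_sum_nth)
    moreover have "(fps_const fps_X + lift_r y) ^ Suc i = fps_const fps_X * P + lift_r y * P"
      by (simp add: P_def distrib_right)
    ultimately show ?thesis by simp
  qed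
  also have "(fps_X * P $ b) $ a = 0"
    using Suc by (cases a) (auto simp: P_def)
  also have "(\<Sum>c=0..b. y $ c * P $ (b - c) $ a) = 0"
  proof (intro sum.neutral ballI)
    fix c assume c: "c \<in> {0..b}"
    show "y $ c * P $ (b - c) $ a = 0"
    proof (cases "c = 0")
      case True
      then show ?thesis by (simp add: y0)
    next
      case False
      then have "P $ (b - c) $ a = 0" unfolding P_def using Suc c by auto
      then show ?thesis by simp
    qed
  qed
  finally show ?case by simp
qed

(* The power series in t given by (d/dr)^m v(t + y(r)) at r = 0; the coefficient ring of the outer
   series consists of the series in t, which fps_deriv therefore treats as constants. *)
definition r_deriv_at_0 :: "nat \<Rightarrow> 'a::comm_ring_1 fps \<Rightarrow> 'a fps \<Rightarrow> 'a fps" where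
  "r_deriv_at_0 m v y = ((fps_deriv ^^ m) (fps_shift_arg v y)) $ 0"

definition fps_op ::
    "'a::real_normed_field fps \<Rightarrow> ('a \<Rightarrow> 'a) \<Rightarrow> 'a \<Rightarrow> 'a" where
  "fps_op v f x = (\<Sum>i. v $ i * (deriv ^^ i) f x)"

(* v(d/dx) f is well defined on the open set S: every derivative of f that occurs with a nonzero
   coefficient exists on S (so finitely many derivatives suffice if v is a polynomial), and the
   series converges at each point of S.  The conditions are needed because deriv and suminf
   are total functions. *)
definition fps_op_defined_on ::
    "'a::real_normed_field fps \<Rightarrow> 'a set \<Rightarrow> ('a \<Rightarrow> 'a) \<Rightarrow> bool" where
  "fps_op_defined_on v S f \<longleftrightarrow>
     (\<forall>i. v $ i \<noteq> 0 \<longrightarrow> (\<forall>l<i. \<forall>x\<in>S. (deriv ^^ l) f field_differentiable (at x))) \<and>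
     (\<forall>x\<in>S. summable (\<lambda>i. v $ i * (deriv ^^ i) f x))"

end

theory Submission
  imports Defs
begin

text \<open>
  Write \<open>y\<close> for the compositional inverse of \<open>k\<close> and \<open>W l\<close> for the value at \<open>x\<close> of the operator
  \<open>v\<^sup>(\<^sup>l\<^sup>)(\<partial>\<^sub>x) / l!\<close> applied to \<open>j\<close>. By the Leibniz rule the left-hand side is
  \<open>\<Sum>l\<le>n. s\<^sub>n\<^sup>(\<^sup>l\<^sup>)(x) W l\<close>. By Taylor expansion in \<open>y(r)\<close>, the operator attached to the \<open>m\<close>-th
  derivative in \<open>r\<close> gives \<open>m! \<Sum>l\<le>m. [r\<^sup>m] y(r)\<^sup>l W l\<close>. Differentiating the generating function of
  the Sheffer sequence \<open>l\<close> times in \<open>x\<close> multiplies it by \<open>y\<^sup>l\<close>, which matches the two sums.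
  The series \<open>W l\<close> converge because the matrix \<open>[r\<^sup>m] y(r)\<^sup>l\<close> is triangular with nonzero
  diagonal and the combinations on the right-hand side converge by hypothesis.
\<close>

section \<open>Taylor expansion of v(t + y(r))\<close>

lemma lift_r_power:
  fixes y :: "'a::comm_ring_1 fps"
  shows "lift_r y ^ n = lift_r (y ^ n)"
proof (induction n)
  case 0
  show ?case by (auto simp: lift_r_def fps_eq_iff)
next
  case (Suc n)
  have "lift_r y * lift_r (y ^ n) = lift_r (y * y ^ n)"
    by (auto simp: lift_r_def fps_eq_iff fps_mult_nth fps_sum_nth)
  then show ?case by (simp add: Suc)
qed

lemma shift_power_nth:
  fixes y :: "'a::comm_ring_1 fps"
  shows "((fps_const fps_X + lift_r y) ^ i) $ b $ a =
    (if a \<le> i then of_nat (i choose a) * (y ^ (i - a)) $ b else 0)"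
proof -
  have "((fps_const fps_X + lift_r y) ^ i) $ b $ a =
     (\<Sum>c\<le>i. (of_nat (i choose c) * fps_const fps_X ^ c * lift_r (y ^ (i - c))) $ b $ a)"
    by (simp add: binomial_ring lift_r_power fps_sum_nth)
  also have "\<dots> = (\<Sum>c\<le>i. if c = a then of_nat (i choose c) * (y ^ (i - c)) $ b else 0)"
  proof (rule sum.cong[OF refl])
    fix c
    \<comment> \<open>Everything except the power of y is constant in r, so the r-coefficient comes
      from y alone and the remaining monomial t^c selects c = a.\<close>
    have "of_nat (i choose c) * fps_const fps_X ^ c * lift_r (y ^ (i - c)) =
        fps_const (fps_const (of_nat (i choose c)) * fps_X ^ c) * lift_r (y ^ (i - c))"
      by (simp add: fps_const_power flip: fps_of_nat)
    then show "(of_nat (i choose c) * fps_const fps_X ^ c * lift_r (y ^ (i - c))) $ b $ a =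
        (if c = a then of_nat (i choose c) * (y ^ (i - c)) $ b else 0)"
      by (simp add: lift_r_def mult.assoc)
  qed
  finally show ?thesis by (simp add: sum.delta')
qed

text \<open>The m-th derivative at r = 0 is m! times the coefficient of r^m. The sum is the t^a
  coefficient in the expansion of v(t + y) into terms v^(l)(t) y^l / l!; the bound l \<le> m stems
  from the cutoff i \<le> a + m in \<open>fps_shift_arg\<close>.\<close>

lemma r_deriv_at_0_nth:
  fixes y :: "'a::{comm_ring_1, ring_char_0} fps"
  shows "r_deriv_at_0 m v y $ a =
    fact m * (\<Sum>l\<le>m. v $ (a + l) * of_nat ((a + l) choose l) * (y ^ l) $ m)"
proof -
  have "r_deriv_at_0 m v y = fact m * fps_shift_arg v y $ m"
    by (simp add: r_deriv_at_0_def fps_0th_higher_deriv)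
  also have "(fact m :: 'a fps) = fps_const (fact m)"
    by (metis fps_of_nat of_nat_fact)
  finally have "r_deriv_at_0 m v y $ a = fact m * (fps_shift_arg v y $ m $ a)"
    by simp
  also have "fps_shift_arg v y $ m $ a =
      (\<Sum>i\<in>{a..a+m}. v $ i * (of_nat (i choose a) * (y ^ (i - a)) $ m))"
    by (auto simp: fps_shift_arg_def shift_power_nth intro!: sum.mono_neutral_cong_right)
  also have "\<dots> = (\<Sum>l\<le>m. v $ (a + l) * of_nat ((a + l) choose l) * (y ^ l) $ m)"
    by (rule sum.reindex_bij_witness[of _ "\<lambda>l. a + l" "\<lambda>i. i - a"])
       (auto simp: mult.assoc simp flip: binomial_symmetric)
  finally show ?thesis .
qed

section \<open>Leibniz rule\<close>

text \<open>Pascal's rule, in the shape of the induction step of the Leibniz rule: the bracket is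
  the derivative of a product whose factors have derivatives \<open>a\<close> and
  \<open>b\<close>.\<close>

lemma binomial_convolution_Suc:
  fixes a b :: "nat \<Rightarrow> 'a::comm_ring_1"
  shows "(\<Sum>l\<le>Suc i. of_nat (Suc i choose l) * a l * b (Suc i - l)) =
    (\<Sum>l\<le>i. of_nat (i choose l) * (a (Suc l) * b (i - l) + a l * b (Suc (i - l))))"
proof -
  have "(\<Sum>l\<le>Suc i. of_nat (Suc i choose l) * a l * b (Suc i - l)) =
      a 0 * b (Suc i) + (\<Sum>l\<le>i. of_nat (Suc i choose Suc l) * a (Suc l) * b (i - l))"
    by (subst sum.atMost_Suc_shift) simp
  also have "(\<Sum>l\<le>i. of_nat (Suc i choose Suc l) * a (Suc l) * b (i - l)) =
      (\<Sum>l\<le>i. of_nat (i choose l) * a (Suc l) * b (i - l)) +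
      (\<Sum>l\<le>i. of_nat (i choose Suc l) * a (Suc l) * b (i - l))"
    by (simp add: sum.distrib algebra_simps)
  also have "a 0 * b (Suc i) + (\<dots>) =
      (\<Sum>l\<le>i. of_nat (i choose l) * a (Suc l) * b (i - l)) +
      (\<Sum>l\<le>Suc i. of_nat (i choose l) * a l * b (Suc i - l))"
    by (subst sum.atMost_Suc_shift) (simp add: binomial_eq_0)
  also have "(\<Sum>l\<le>Suc i. of_nat (i choose l) * a l * b (Suc i - l)) =
      (\<Sum>l\<le>i. of_nat (i choose l) * a l * b (Suc (i - l)))"
    by (simp add: Suc_diff_le binomial_eq_0)
  finally show ?thesis by (simp add: sum.distrib algebra_simps)
qed

lemma higher_deriv_poly_mult:
  fixes j :: "'a::real_normed_field \<Rightarrow> 'a"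
  assumes S: "open S"
    and diff: "\<And>l x. l < i \<Longrightarrow> x \<in> S \<Longrightarrow> (deriv ^^ l) j field_differentiable (at x)"
    and x: "x \<in> S"
  shows "(deriv ^^ i) (\<lambda>x. poly p x * j x) x =
    (\<Sum>l\<le>i. of_nat (i choose l) * poly ((pderiv ^^ l) p) x * (deriv ^^ (i - l)) j x)"
  using diff x
proof (induction i arbitrary: x)
  case 0
  then show ?case by simp
next
  case (Suc i)
  define f where
    "f z = (\<Sum>l\<le>i. of_nat (i choose l) * (poly ((pderiv ^^ l) p) z * (deriv ^^ (i - l)) j z))" for z
  have d: "((\<lambda>x. poly q x * (deriv ^^ l) j x) has_field_derivative
      poly (pderiv q) x * (deriv ^^ l) j x + poly q x * deriv ((deriv ^^ l) j) x) (at x)"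
    if "l \<le> i" for l q
  proof -
    have "((deriv ^^ l) j has_field_derivative deriv ((deriv ^^ l) j) x) (at x)"
      using Suc.prems that by (simp add: DERIV_deriv_iff_field_differentiable)
    from DERIV_mult[OF poly_DERIV[of q] this] show ?thesis by (simp add: algebra_simps)
  qed
  have f_DERIV: "(f has_field_derivative
      (\<Sum>l\<le>i. of_nat (i choose l) * (poly ((pderiv ^^ Suc l) p) x * (deriv ^^ (i - l)) j x +
         poly ((pderiv ^^ l) p) x * (deriv ^^ Suc (i - l)) j x))) (at x)"
    unfolding f_def
    by (intro DERIV_sum DERIV_cmult) (use d in simp)
  have f_eq: "(deriv ^^ i) (\<lambda>x. poly p x * j x) z = f z" if "z \<in> S" for z
    using Suc.IH[of z] Suc.prems(1) that by (simp add: f_def mult.assoc)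
  have "((deriv ^^ i) (\<lambda>x. poly p x * j x) has_field_derivative
      (\<Sum>l\<le>i. of_nat (i choose l) * (poly ((pderiv ^^ Suc l) p) x * (deriv ^^ (i - l)) j x +
         poly ((pderiv ^^ l) p) x * (deriv ^^ Suc (i - l)) j x))) (at x)"
    \<comment> \<open>The inductive formula holds on all of the open set \<open>S\<close>, not only
      at \<open>x\<close>, and hence may be differentiated at \<open>x\<close>.\<close>
    using f_eq by (intro has_field_derivative_transform_within_open[OF f_DERIV S \<open>x \<in> S\<close>]) simp
  then have "(deriv ^^ Suc i) (\<lambda>x. poly p x * j x) x =
      (\<Sum>l\<le>i. of_nat (i choose l) * (poly ((pderiv ^^ Suc l) p) x * (deriv ^^ (i - l)) j x +
         poly ((pderiv ^^ l) p) x * (deriv ^^ Suc (i - l)) j x))"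
    by (simp add: DERIV_imp_deriv)
  then show ?case
    by (simp only: binomial_convolution_Suc[of i "\<lambda>l. poly ((pderiv ^^ l) p) x"
          "\<lambda>l. (deriv ^^ l) j x"])
qed

section \<open>Derivatives of Sheffer polynomials\<close>

text \<open>Each coefficient is a finite sum of powers of x. Differentiating e^(x t) in x brings
  down a factor t, which turns into y under the composition.\<close>

lemma fps_exp_compose_nth_DERIV:
  fixes y :: "'a::real_normed_field fps"
  assumes y0: "y $ 0 = 0"
  shows "((\<lambda>x. (fps_exp x oo y) $ m) has_field_derivative (y * (fps_exp x oo y)) $ m) (at x)"
proof -
  have "((\<lambda>x. fps_exp x $ i * y ^ i $ m) has_field_derivative
      (fps_X * fps_exp x) $ i * y ^ i $ m) (at x)" for i
  proof (cases i)
    case 0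
    then show ?thesis by simp
  next
    case (Suc l)
    have "((\<lambda>x. x ^ Suc l / fact (Suc l)) has_field_derivative x ^ l / fact l) (at x)"
      using DERIV_cdivide[OF DERIV_power_Suc[OF DERIV_ident, of l x], of "fact (Suc l)"]
      by (simp del: power_Suc of_nat_Suc flip: of_nat_Suc)
    then show ?thesis
      unfolding Suc by (intro DERIV_cmult_right) (simp add: fps_exp_def)
  qed
  then have "((\<lambda>x. (fps_exp x oo y) $ m) has_field_derivative ((fps_X * fps_exp x) oo y) $ m) (at x)"
    unfolding fps_compose_nth by (intro DERIV_sum)
  then show ?thesis
    by (simp add: fps_compose_mult_distrib[OF y0] y0)
qed

text \<open>The generating identity can be differentiated in x coefficient by coefficient: the
  factor 1/g(y(t)) is free of x, and e^(x y(t)) gains a factor y(t) each time. Uniqueness of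
  derivatives turns this into an equality of series.\<close>

lemma sheffer_higher_pderiv:
  fixes g k :: "'a::real_normed_field fps"
  assumes s: "is_sheffer_seq g k s"
  shows "Abs_fps (\<lambda>n. poly ((pderiv ^^ l) (s n)) x / fact n) =
    fps_inv k ^ l * Abs_fps (\<lambda>n. poly (s n) x / fact n)"
proof -
  define Q where "Q l x = Abs_fps (\<lambda>n. poly ((pderiv ^^ l) (s n)) x / fact n)" for l x
  have y0: "fps_inv k $ 0 = 0" by (simp add: fps_inv_def)
  have Q_DERIV: "((\<lambda>x. Q l x $ n) has_field_derivative Q (Suc l) x $ n) (at x)" for l x n
    by (auto simp: Q_def intro!: DERIV_cdivide)
  have mult_DERIV: "((\<lambda>x. (c * f x) $ n) has_field_derivative (c * f') $ n) (at x)"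
    if "\<And>n. ((\<lambda>x. f x $ n) has_field_derivative f' $ n) (at x)"
    for c f' :: "'a fps" and f :: "'a \<Rightarrow> 'a fps" and x n
    unfolding fps_mult_nth by (intro DERIV_sum DERIV_cmult that)
  have Q_0: "Q 0 x = inverse (g oo fps_inv k) * (fps_exp x oo fps_inv k)" for x
    using s by (simp add: Q_def is_sheffer_seq_def)
  have Q_1: "Q (Suc 0) x = fps_inv k * Q 0 x" for x
  proof (rule fps_ext)
    fix n
    have "((\<lambda>x. Q 0 x $ n) has_field_derivative
        (inverse (g oo fps_inv k) * (fps_inv k * (fps_exp x oo fps_inv k))) $ n) (at x)"
      unfolding Q_0 by (intro mult_DERIV fps_exp_compose_nth_DERIV y0)
    then show "Q (Suc 0) x $ n = (fps_inv k * Q 0 x) $ n"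
      using DERIV_unique[OF Q_DERIV] by (simp add: Q_0 mult_ac)
  qed
  have "Q l x = fps_inv k ^ l * Q 0 x" for x
  proof (induction l arbitrary: x)
    case 0
    then show ?case by simp
  next
    case (Suc l)
    show ?case
    proof (rule fps_ext)
      fix n
      have "((\<lambda>x. Q l x $ n) has_field_derivative (fps_inv k ^ l * Q (Suc 0) x) $ n) (at x)"
        unfolding Suc by (intro mult_DERIV Q_DERIV)
      then show "Q (Suc l) x $ n = (fps_inv k ^ Suc l * Q 0 x) $ n"
        using DERIV_unique[OF Q_DERIV] by (simp add: Q_1 mult_ac)
    qed
  qed
  then show ?thesis by (simp add: Q_def)
qed

lemma sheffer_higher_pderiv_poly:
  fixes g k :: "'a::real_normed_field fps"
  assumes s: "is_sheffer_seq g k s"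
  shows "poly ((pderiv ^^ l) (s n)) x =
    (\<Sum>m=0..n. of_nat (n choose m) * poly (s (n - m)) x * (fact m * (fps_inv k ^ l) $ m))"
proof -
  have "poly ((pderiv ^^ l) (s n)) x / fact n =
      (\<Sum>m=0..n. (fps_inv k ^ l) $ m * (poly (s (n - m)) x / fact (n - m)))"
    using arg_cong[OF sheffer_higher_pderiv[OF s, of l x], of "\<lambda>f. f $ n"]
    by (simp add: fps_mult_nth)
  then have "poly ((pderiv ^^ l) (s n)) x =
      (\<Sum>m=0..n. fact n * ((fps_inv k ^ l) $ m * (poly (s (n - m)) x / fact (n - m))))"
    by (simp add: field_simps sum_distrib_left)
  also have "\<dots> =
      (\<Sum>m=0..n. of_nat (n choose m) * poly (s (n - m)) x * (fact m * (fps_inv k ^ l) $ m))"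
    by (intro sum.cong refl) (simp add: binomial_fact field_simps)
  finally show ?thesis .
qed

section \<open>Convergence and the main identity\<close>

text \<open>Forward substitution: once the earlier series converge, subtracting them from the m-th
  combination leaves \<open>c m m * W m i\<close>, and the diagonal entry can be divided
  out.\<close>

lemma summable_if_triangular_combinations_summable:
  fixes W :: "nat \<Rightarrow> nat \<Rightarrow> 'a::real_normed_field"
  assumes sm: "\<And>m. m \<le> n \<Longrightarrow> summable (\<lambda>i. \<Sum>l\<le>m. c m l * W l i)"
    and c: "\<And>m. m \<le> n \<Longrightarrow> c m m \<noteq> 0"
    and "m \<le> n"
  shows "summable (W m)"
  using \<open>m \<le> n\<close>
proof (induction m rule: less_induct)
  case (less m)
  have "summable (\<lambda>i. (\<Sum>l\<le>m. c m l * W l i) - (\<Sum>l<m. c m l * W l i))"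
    using less by (intro summable_diff sm summable_sum summable_mult) auto
  also have "(\<lambda>i. (\<Sum>l\<le>m. c m l * W l i) - (\<Sum>l<m. c m l * W l i)) = (\<lambda>i. c m m * W m i)"
    by (simp flip: lessThan_Suc_atMost)
  finally show ?case using c[OF less.prems] by (simp add: summable_cmult_iff)
qed

theorem theorem3p1:
  fixes g k v :: "'a::real_normed_field fps"
    and s :: "nat \<Rightarrow> 'a poly"
    and j :: "'a \<Rightarrow> 'a"
    and S :: "'a set"
    and n :: nat
  assumes g: "g \<noteq> 0" "subdegree g = 0"
    and k: "k \<noteq> 0" "subdegree k = 1"
    and s: "is_sheffer_seq g k s"
    and n: "n > 0"
    and S: "open S"
    and lhs_defined: "fps_op_defined_on v S (\<lambda>x. poly (s n) x * j x)"
    and rhs_defined: "\<And>m. m \<le> n \<Longrightarrow> fps_op_defined_on (r_deriv_at_0 m v (fps_inv k)) S j"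
    and x: "x \<in> S"
  shows "fps_op v (\<lambda>x. poly (s n) x * j x) x =
    (\<Sum>m=0..n. of_nat (n choose m) * poly (s (n - m)) x * fps_op (r_deriv_at_0 m v (fps_inv k)) j x)"
proof -
  define y where "y = fps_inv k"
  have y0: "y $ 0 = 0" by (simp add: y_def fps_inv_def)
  have "k $ 1 \<noteq> 0" using k nth_subdegree_nonzero by metis
  then have y1: "y $ 1 \<noteq> 0" by (simp add: y_def fps_inv_def)
  \<comment> \<open>\<open>W l a\<close> is the a-th term of the operator v^(l)/l! applied to
    \<open>j\<close> at \<open>x\<close>; its value is \<open>suminf (W l)\<close>.\<close>
  define W where "W l a = v $ (a + l) * of_nat ((a + l) choose l) * (deriv ^^ a) j x" for l a
  define D where "D l = poly ((pderiv ^^ l) (s n)) x" for l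

  have r_term: "r_deriv_at_0 m v y $ a * (deriv ^^ a) j x = (\<Sum>l\<le>m. fact m * (y ^ l) $ m * W l a)"
    for m a
    by (simp add: r_deriv_at_0_nth W_def sum_distrib_left sum_distrib_right mult_ac)
  have W_summable: "summable (W l)" if "l \<le> n" for l
  proof (rule summable_if_triangular_combinations_summable[where c = "\<lambda>m l. fact m * (y ^ l) $ m"])
    show "summable (\<lambda>i. \<Sum>l\<le>m. fact m * (y ^ l) $ m * W l i)" if "m \<le> n" for m
    proof -
      have "summable (\<lambda>i. r_deriv_at_0 m v y $ i * (deriv ^^ i) j x)"
        using rhs_defined[OF that] x by (simp add: fps_op_defined_on_def y_def)
      then show ?thesis by (simp only: r_term)
    qed
    \<comment> \<open>Since y starts with its linear term, the diagonal entry is m! times the m-th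
      power of \<open>y $ 1\<close>.\<close>
    show "fact m * (y ^ m) $ m \<noteq> 0" if "m \<le> n" for m
      using y1 by (simp add: startsby_zero_power_nth_same[OF y0])
  qed (fact that)
  have r_op: "fps_op (r_deriv_at_0 m v y) j x = (\<Sum>l\<le>m. fact m * (y ^ l) $ m * suminf (W l))"
    if "m \<le> n" for m
    unfolding fps_op_def r_term using that
    by (intro sums_unique[symmetric] sums_sum sums_mult summable_sums W_summable) auto

  \<comment> \<open>For m = 0 the operator is v itself, so the hypothesis on the right-hand side
    yields differentiability of \<open>j\<close> alone, as the Leibniz rule requires.\<close>
  have "r_deriv_at_0 0 v y = v"
    by (simp add: fps_eq_iff r_deriv_at_0_nth)
  then have j_diff: "(deriv ^^ l) j field_differentiable (at z)"
    if "v $ i \<noteq> 0" "l < i" "z \<in> S" for i l z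
    using rhs_defined[of 0] that by (auto simp: fps_op_defined_on_def y_def)
  \<comment> \<open>This serves as the degree bound for \<open>s n\<close>: only coefficients of y^l
    up to index n enter, and y^l starts at index l.\<close>
  have D_eq_0: "D l = 0" if "l > n" for l
    unfolding D_def sheffer_higher_pderiv_poly[OF s]
    using that startsby_zero_power_prefix[OF y0, of l] by (intro sum.neutral) (auto simp: y_def)
  \<comment> \<open>The range of \<open>l\<close> is made independent of \<open>i\<close>, so that
    the series can be summed for each \<open>l\<close> separately. If \<open>v $ i = 0\<close>, the
    derivatives of \<open>j\<close> may not exist, but \<open>W l (i - l)\<close> contains the
    factor \<open>v $ i\<close>.\<close>
  have lhs_term: "v $ i * (deriv ^^ i) (\<lambda>x. poly (s n) x * j x) x =
      (\<Sum>l\<le>n. D l * (if l \<le> i then W l (i - l) else 0))" for i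
  proof (cases "v $ i = 0")
    case True
    then show ?thesis by (simp add: W_def sum.neutral)
  next
    case False
    have "v $ i * (deriv ^^ i) (\<lambda>x. poly (s n) x * j x) x = (\<Sum>l\<le>i. D l * W l (i - l))"
      using higher_deriv_poly_mult[OF S j_diff[OF False] x, where p = "s n"]
      by (auto simp: D_def W_def sum_distrib_left mult_ac intro!: sum.cong)
    also have "\<dots> = (\<Sum>l\<in>{..n} \<inter> {..i}. D l * W l (i - l))"
      by (intro sum.mono_neutral_right) (auto simp: D_eq_0)
    also have "\<dots> = (\<Sum>l\<le>n. D l * (if l \<le> i then W l (i - l) else 0))"
      by (intro sum.mono_neutral_cong_left) auto
    finally show ?thesis .
  qed
  \<comment> \<open>Prepending \<open>l\<close> zeros does not change the sum.\<close>
  have W_shift: "(\<lambda>i. if l \<le> i then W l (i - l) else 0) sums suminf (W l)" if "l \<le> n" for l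
    by (subst sums_zero_iff_shift[symmetric, of l])
       (use W_summable[OF that] in \<open>auto simp: summable_sums\<close>)

  have "fps_op v (\<lambda>x. poly (s n) x * j x) x = (\<Sum>l\<le>n. D l * suminf (W l))"
    unfolding fps_op_def lhs_term
    by (intro sums_unique[symmetric] sums_sum sums_mult W_shift) auto
  also have "\<dots> = (\<Sum>l\<le>n. \<Sum>m=0..n. of_nat (n choose m) * poly (s (n - m)) x *
      (fact m * (y ^ l) $ m * suminf (W l)))"
    by (simp add: D_def sheffer_higher_pderiv_poly[OF s] y_def sum_distrib_right mult.assoc)
  also have "\<dots> = (\<Sum>m=0..n. \<Sum>l\<le>n. of_nat (n choose m) * poly (s (n - m)) x *
      (fact m * (y ^ l) $ m * suminf (W l)))"
    by (rule sum.swap)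
  also have "\<dots> = (\<Sum>m=0..n. of_nat (n choose m) * poly (s (n - m)) x *
      (\<Sum>l\<le>n. fact m * (y ^ l) $ m * suminf (W l)))"
    by (simp add: sum_distrib_left)
  also have "\<dots> = (\<Sum>m=0..n. of_nat (n choose m) * poly (s (n - m)) x *
      fps_op (r_deriv_at_0 m v y) j x)"
  proof (intro sum.cong refl arg_cong2[where f = "(*)"])
    fix m assume m: "m \<in> {0..n}"
    \<comment> \<open>The terms with l > m vanish because y^l starts at index l.\<close>
    have "(\<Sum>l\<le>n. fact m * (y ^ l) $ m * suminf (W l)) =
        (\<Sum>l\<le>m. fact m * (y ^ l) $ m * suminf (W l))"
      using m startsby_zero_power_prefix[OF y0] by (intro sum.mono_neutral_right) auto
    then show "(\<Sum>l\<le>n. fact m * (y ^ l) $ m * suminf (W l)) = fps_op (r_deriv_at_0 m v y) j x"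
      using m by (simp add: r_op)
  qed
  finally show ?thesis by (simp add: y_def)
qed

end
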